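(* Let $G$ be an abelian group. The endomorphism graph of $G$ is planar if and only if $|G|\le 4$.
   Context: The endomorphism graph of a group $G$ is the simple undirected graph with vertex set $G$ in which distinct $x,y$ are adjacent if and only if some endomorphism of $G$ maps $x$ to $y$ or maps $y$ to $x$. *)

theory Defs
  imports "HOL-Algebra.Group" "HOL-Analysis.Analysis"
begin

text \<open>
  A simple undirected graph is a pair \<open>(V, E)\<close> of a vertex set and a set of edges, each edge
  being a two-element subset of \<open>V\<close>. The vertex set may be infinite.
\<close>

type_synonym 'a ugraph = "'a set \<times> 'a set set"

text \<open>
  Elements of \<open>hom G G\<close> are only constrained on the carrier; their values elsewhere are
  irrelevant here because \<open>x\<close> and \<open>y\<close> range over the carrier.
\<close>

definition endomorphism_graph :: "('a, 'b) monoid_scheme \<Rightarrow> 'a ugraph" where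
  "endomorphism_graph G =
    (carrier G,
     {{x, y} | x y. x \<in> carrier G \<and> y \<in> carrier G \<and> x \<noteq> y \<and>
        (\<exists>f \<in> hom G G. f x = y \<or> f y = x)})"

text \<open>
  A drawing of a graph in the plane (identified with \<^typ>\<open>complex\<close>): \<open>p\<close> places the vertices at
  distinct points, and \<open>g\<close> draws each edge as a simple non-closed arc joining its two ends, such
  that apart from its ends the arc contains no vertex and no point of another edge.
\<close>

definition plane_drawing ::
  "'a ugraph \<Rightarrow> ('a \<Rightarrow> complex) \<Rightarrow> ('a set \<Rightarrow> real \<Rightarrow> complex) \<Rightarrow> bool" where
  "plane_drawing \<Gamma> p g \<longleftrightarrow>
    inj_on p (fst \<Gamma>) \<and>
    (\<forall>e \<in> snd \<Gamma>. arc (g e) \<and> {pathstart (g e), pathfinish (g e)} = p ` e) \<and>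
    (\<forall>e \<in> snd \<Gamma>. (path_image (g e) - p ` e) \<inter> p ` fst \<Gamma> = {}) \<and>
    (\<forall>e \<in> snd \<Gamma>. \<forall>e' \<in> snd \<Gamma>. e \<noteq> e' \<longrightarrow>
       (path_image (g e) - p ` e) \<inter> path_image (g e') = {})"

definition planar :: "'a ugraph \<Rightarrow> bool" where
  "planar \<Gamma> \<longleftrightarrow> (\<exists>p g. plane_drawing \<Gamma> p g)"

end

theory Submission
  imports Defs "HOL-Algebra.Generated_Groups"
begin

text \<open>
  A graph with at most four vertices is a subgraph of the complete graph on four vertices, which has a
  drawing with straight edges (\<open>planar_if_at_most_4_vertices\<close>). For the converse, an abelian group with
  more than four elements is shown to contain five elements that are pairwise adjacent in its
  endomorphism graph. The complete graph on five vertices is not planar.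

  The five elements are found as follows. If some \<open>x\<close> has infinite order or order at least \<open>5\<close>, the powers
  of \<open>x\<close> with exponents \<open>0\<close>, \<open>1\<close>, \<open>-1\<close>, \<open>2\<close>, \<open>-2\<close> are distinct and pairwise related by power maps
  (\<open>nonplanar_if_order_gt_4\<close>). Otherwise all orders are at most \<open>4\<close>, and since no element has order \<open>6\<close> the
  exponent \<open>n\<close> of the group is \<open>2\<close>, \<open>3\<close> or \<open>4\<close>. An element \<open>x\<close> of order \<open>n\<close> then generates a direct factor, so
  that endomorphisms map it to every element of the group (\<open>endomorphism_from_max_order\<close>). In a group with
  more than four elements there are four elements of order \<open>n\<close>, and the identity is the fifth vertex of
  a clique.

  That the complete graph on \<open>a\<close>, \<open>b\<close>, \<open>c\<close>, \<open>d\<close>, \<open>e\<close> is not planar rests on the Jordan curve theorem and the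
  theta-curve theorem. The vertices \<open>d\<close> and \<open>e\<close> lie on the same side of the triangle \<open>abc\<close>. If this is the
  inside, the edges from \<open>d\<close> divide it into three triangles; \<open>e\<close> lies inside one of them and is
  separated from the opposite vertex (\<open>no_vertex_inside_triangle\<close>). If it is the outside, an inversion at a
  point inside the triangle exchanges the two sides (\<open>inversion_outside_to_inside\<close>).
\<close>

section \<open>Inside and outside in the plane\<close>

text \<open>
  Inversion at a point \<open>z\<close> inside \<open>S\<close> takes the outside of \<open>S\<close>, completed by the point at infinity, to an
  open neighbourhood \<open>U\<close> of \<open>0\<close>. As \<open>z\<close> has a positive distance from the outside of \<open>S\<close>, the set \<open>U\<close> is
  bounded. A component of the complement of the image of \<open>S\<close> that meets \<open>U\<close> lies in \<open>U\<close>, since the rest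
  of that complement is the image of the inside of \<open>S\<close> and is open as well.
\<close>

lemma inversion_outside_to_inside:
  fixes S :: "complex set"
  assumes S: "compact S" and z: "z \<in> inside S" and w: "w \<in> outside S"
  shows "1 / (w - z) \<in> inside ((\<lambda>x. 1 / (x - z)) ` S)"
proof -
  define f where "f = (\<lambda>x. 1 / (x - z))"
  define h where "h = (\<lambda>y. z + 1 / y)"
  \<comment> \<open>The outside and the inside of \<open>S\<close> as seen through the inversion, whose inverse is \<open>h\<close>;
    \<open>0\<close> is the image of the point at infinity.\<close>
  define U where "U = {y. y = 0 \<or> h y \<in> outside S}"
  define W where "W = {y. y \<noteq> 0 \<and> h y \<in> inside S}"
  define K where "K = connected_component_set (- f ` S) (f w)"
  have fh: "f (h y) = y" if "y \<noteq> 0" for y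
    using that by (simp add: f_def h_def)
  have hf: "h (f x) = x" if "x \<noteq> z" for x
    using that by (simp add: f_def h_def)
  have wz: "w \<noteq> z" using z w inside_Int_outside by blast
  have zS: "z \<notin> S" using z inside_no_overlap by blast
  have clS: "closed S" using S compact_imp_closed by blast
  have conth: "continuous_on (-{0}) h"
    unfolding h_def by (intro continuous_intros) auto
  have oh: "open (h -` A \<inter> -{0})" if "open A" for A
    using continuous_open_vimage[of A h] conth that
    by (metis Int_commute continuous_on_open_vimage open_Compl closed_singleton)
  have "bounded (S \<union> inside S)"
    using S bounded_inside compact_imp_bounded by auto
  then obtain B where B: "B > 0" "\<And>x. x \<in> S \<union> inside S \<Longrightarrow> norm x \<le> B"
    by (meson bounded_pos)
  define C where "C = B + norm z"
  have C0: "C > 0" unfolding C_def using B(1) by (simp add: add_pos_nonneg)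
  have nearout: "h y \<in> outside S" if y: "y \<in> ball 0 (1 / C)" "y \<noteq> 0" for y
  proof -
    have "norm y < 1 / C" using y by simp
    then have "norm (1 / y) > C"
      using C0 y(2) by (simp add: norm_divide field_simps)
    moreover have "norm (1 / y) \<le> norm (h y) + norm z"
      unfolding h_def using norm_triangle_ineq4[of "z + 1/y" z] by simp
    ultimately have "norm (h y) > B" unfolding C_def by linarith
    then have "h y \<notin> S \<union> inside S" using B(2) by force
    then show ?thesis by (simp add: union_with_inside)
  qed
  have "U = (h -` outside S \<inter> -{0}) \<union> ball 0 (1 / C)"
    using nearout C0 by (auto simp: U_def set_eq_iff)
  then have oU: "open U" using oh[OF open_outside[OF clS]] by auto
  have "W = h -` inside S \<inter> -{0}" unfolding W_def by auto
  then have oW: "open W" using oh[OF open_inside[OF clS]] by auto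
  obtain r where r: "r > 0" "ball z r \<subseteq> inside S"
    using open_inside[OF clS] z openE by blast
  have "norm y \<le> 1 / r" if "y \<in> U" for y
  proof (cases "y = 0")
    case True then show ?thesis using r by simp
  next
    case False
    then have "h y \<notin> ball z r"
      using that r(2) inside_Int_outside unfolding U_def by blast
    then have "norm (1 / y) \<ge> r" by (simp add: h_def dist_norm norm_divide)
    then show ?thesis using False r(1) by (simp add: norm_divide field_simps)
  qed
  then have bU: "bounded U" by (meson boundedI)
  have fwS: "f w \<notin> f ` S"
  proof
    assume "f w \<in> f ` S"
    then obtain x where "x \<in> S" "f w = f x" by blast
    then have "w \<in> S" using hf zS wz by metis
    then show False using w outside_no_overlap by blast
  qed
  have fwU: "f w \<in> U" using hf[OF wz] w unfolding U_def by simp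
  have conK: "connected K" unfolding K_def by simp
  have fwK: "f w \<in> K" unfolding K_def using fwS by (simp add: connected_component_refl)
  have "K \<subseteq> U \<union> W"
  proof
    fix y assume "y \<in> K"
    then have y: "y \<notin> f ` S" unfolding K_def using connected_component_subset by blast
    show "y \<in> U \<union> W"
    proof (cases "y = 0")
      case False
      then have "h y \<notin> S" using y fh by force
      then show ?thesis using False inside_Un_outside unfolding U_def W_def by blast
    qed (simp add: U_def)
  qed
  moreover have "U \<inter> W = {}" unfolding U_def W_def using inside_Int_outside by blast
  ultimately have "K \<subseteq> U"
    using connectedD[OF conK oU oW] fwU fwK by blast
  then have "bounded K" using bU bounded_subset by blast
  then show ?thesis using fwS unfolding K_def f_def inside_def by auto
qed

text \<open>
  Without its last point an arc is still connected. Edges from a vertex off a triangle to a corner of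
  that triangle are of this kind: they meet the triangle in their last point only.
\<close>

lemma inside_along_path:
  fixes c :: "real \<Rightarrow> complex"
  assumes "arc c" "path_image c \<inter> S \<subseteq> {pathfinish c}"
    and "w \<in> path_image c" "w \<in> inside S" "w \<noteq> pathfinish c"
  shows "path_image c - {pathfinish c} \<subseteq> inside S"
proof
  fix y assume y: "y \<in> path_image c - {pathfinish c}"
  have inj: "inj_on c {0..1}" and cont: "continuous_on {0..1} c"
    using assms(1) by (auto simp: arc_def path_def)
  have eq: "path_image c - {pathfinish c} = c ` {0..<1}"
  proof -
    have "{0..<1::real} = {0..1} - {1}" by auto
    then show ?thesis
      using inj_on_image_set_diff[OF inj, of "{0..1}" "{1}"]
      by (simp add: path_image_def pathfinish_def)
  qed
  have "connected (c ` {0..<1})"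
    by (rule connected_continuous_image) (auto intro: continuous_on_subset[OF cont])
  moreover have "c ` {0..<1} \<subseteq> - S" using assms(2) eq by blast
  moreover have "w \<in> c ` {0..<1}" using assms eq by auto
  ultimately have "connected_component (- S) w y"
    using y eq unfolding connected_component_def by blast
  then show "y \<in> inside S" using assms(4) inside_same_component by blast
qed

section \<open>The complete graph on five vertices is not planar\<close>

lemma plane_drawing_subgraph:
  assumes sub: "snd \<Delta> \<subseteq> snd \<Gamma>" "fst \<Delta> \<subseteq> fst \<Gamma>"
    and draw: "plane_drawing \<Gamma> p g"
  shows "plane_drawing \<Delta> p g"
  unfolding plane_drawing_def
proof (intro conjI ballI impI)
  note draw = draw[unfolded plane_drawing_def]
  show "inj_on p (fst \<Delta>)" by (rule inj_on_subset[OF conjunct1[OF draw] sub(2)])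
  fix e assume e: "e \<in> snd \<Delta>"
  then have e': "e \<in> snd \<Gamma>" by (rule subsetD[OF sub(1)])
  show "arc (g e)" "{pathstart (g e), pathfinish (g e)} = p ` e" using draw e' by simp_all
  have "(path_image (g e) - p ` e) \<inter> p ` fst \<Gamma> = {}" using draw e' by simp
  then show "(path_image (g e) - p ` e) \<inter> p ` fst \<Delta> = {}" using sub(2) by blast
  fix d assume "d \<in> snd \<Delta>" "e \<noteq> d"
  then show "(path_image (g e) - p ` e) \<inter> path_image (g d) = {}"
    using draw e' sub(1) by (simp add: subset_iff)
qed

definition complete_graph :: "'a set \<Rightarrow> 'a ugraph" where
  "complete_graph V = (V, {{x, y} | x y. x \<in> V \<and> y \<in> V \<and> x \<noteq> y})"

lemma complete_graph_mono:
  assumes "W \<subseteq> V"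
  shows "snd (complete_graph W) \<subseteq> snd (complete_graph V)"
  unfolding complete_graph_def snd_conv using assms by blast

text \<open>
  The edges of a drawing are arcs without a preferred direction; the lemmas below provide directed
  arcs, and paths through two edges, with prescribed ends.
\<close>

locale complete_drawing =
  fixes V :: "'a set" and p :: "'a \<Rightarrow> complex" and g :: "'a set \<Rightarrow> real \<Rightarrow> complex"
  assumes drawing: "plane_drawing (complete_graph V) p g"
begin

definition edge :: "'a \<Rightarrow> 'a \<Rightarrow> complex set" where
  "edge x y = path_image (g {x, y})"

abbreviation triangle :: "'a \<Rightarrow> 'a \<Rightarrow> 'a \<Rightarrow> complex set" where
  "triangle x y z \<equiv> edge x y \<union> edge y z \<union> edge z x"

lemma edge_commute: "edge x y = edge y x"
  by (simp add: edge_def insert_commute)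

lemma p_eq_iff: "x \<in> V \<Longrightarrow> y \<in> V \<Longrightarrow> p x = p y \<longleftrightarrow> x = y"
  using drawing by (auto simp: plane_drawing_def complete_graph_def inj_on_def)

lemma oriented_edge:
  assumes "x \<in> V" "y \<in> V" "x \<noteq> y"
  obtains c where "arc c" "pathstart c = p x" "pathfinish c = p y" "path_image c = edge x y"
proof -
  have e: "arc (g {x, y})" "{pathstart (g {x, y}), pathfinish (g {x, y})} = {p x, p y}"
    using drawing assms by (auto simp: plane_drawing_def complete_graph_def)
  show thesis
  proof (cases "pathstart (g {x, y}) = p x")
    case True
    then have "pathfinish (g {x, y}) = p y"
      using e(2) by (auto simp: doubleton_eq_iff)
    then show ?thesis using that[of "g {x, y}"] e True by (simp add: edge_def)
  next
    case False
    then have "pathstart (g {x, y}) = p y" "pathfinish (g {x, y}) = p x"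
      using e(2) by (auto simp: doubleton_eq_iff)
    then show ?thesis
      using that[of "reversepath (g {x, y})"] e by (simp add: edge_def arc_reversepath)
  qed
qed

lemma ends_in_edge:
  assumes "x \<in> V" "y \<in> V" "x \<noteq> y"
  shows "p x \<in> edge x y" "p y \<in> edge x y"
proof -
  obtain c where "arc c" "pathstart c = p x" "pathfinish c = p y" "path_image c = edge x y"
    using oriented_edge[OF assms] .
  then show "p x \<in> edge x y" "p y \<in> edge x y"
    using pathstart_in_path_image[of c] pathfinish_in_path_image[of c] by simp_all
qed

lemma edge_Int_edge:
  assumes "x \<in> V" "y \<in> V" "x \<noteq> y" "u \<in> V" "v \<in> V" "u \<noteq> v" "{x, y} \<noteq> {u, v}"
  shows "edge x y \<inter> edge u v = p ` ({x, y} \<inter> {u, v})"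
proof
  let ?E = "snd (complete_graph V)"
  have e: "{x, y} \<in> ?E" "{u, v} \<in> ?E"
    using assms by (auto simp: complete_graph_def)
  have "(path_image (g e) - p ` e) \<inter> path_image (g e') = {}"
    if "e \<in> ?E" "e' \<in> ?E" "e \<noteq> e'" for e e'
    using drawing that unfolding plane_drawing_def by blast
  from this[OF e assms(7)] this[OF e(2) e(1) assms(7)[symmetric]]
  have "(path_image (g {x, y}) - p ` {x, y}) \<inter> path_image (g {u, v}) = {}"
       "(path_image (g {u, v}) - p ` {u, v}) \<inter> path_image (g {x, y}) = {}" .
  moreover have "p ` {x, y} \<inter> p ` {u, v} = p ` ({x, y} \<inter> {u, v})"
    using p_eq_iff assms by auto
  ultimately show "edge x y \<inter> edge u v \<subseteq> p ` ({x, y} \<inter> {u, v})"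
    unfolding edge_def by blast
  show "p ` ({x, y} \<inter> {u, v}) \<subseteq> edge x y \<inter> edge u v"
    using ends_in_edge assms by auto
qed

lemma vertex_on_edge:
  assumes "x \<in> V" "y \<in> V" "x \<noteq> y" "v \<in> V" "p v \<in> edge x y"
  shows "v = x \<or> v = y"
proof -
  have "(path_image (g {x, y}) - p ` {x, y}) \<inter> p ` V = {}"
    using drawing assms unfolding plane_drawing_def complete_graph_def snd_conv fst_conv by blast
  then show ?thesis using assms p_eq_iff unfolding edge_def by blast
qed

lemma detour:
  assumes "x \<in> V" "y \<in> V" "z \<in> V" "distinct [x, y, z]"
  obtains c where "arc c" "pathstart c = p x" "pathfinish c = p z"
    "path_image c = edge x y \<union> edge y z"
proof -
  obtain c where c: "arc c" "pathstart c = p x" "pathfinish c = p y" "path_image c = edge x y"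
    using oriented_edge[of x y] assms by auto
  obtain d where d: "arc d" "pathstart d = p y" "pathfinish d = p z" "path_image d = edge y z"
    using oriented_edge[of y z] assms by auto
  have "{x, y} \<inter> {y, z} = {y}" "{x, y} \<noteq> {y, z}" using assms by (auto simp: doubleton_eq_iff)
  then have "edge x y \<inter> edge y z = {p y}"
    using edge_Int_edge[of x y y z] assms by simp
  then have "arc (c +++ d)" using c d by (intro arc_join) auto
  then show thesis
    using that[of "c +++ d"] c d by (simp add: path_image_join)
qed

lemma compact_edge:
  assumes "x \<in> V" "y \<in> V" "x \<noteq> y"
  shows "compact (edge x y)"
proof -
  obtain c where "arc c" "path_image c = edge x y" using oriented_edge[OF assms] by metis
  then show ?thesis using compact_path_image[of c] arc_imp_path[of c] by simp
qed

lemma edge_from_inside: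
  assumes "u \<in> V" "v \<in> V" "u \<noteq> v" "edge u v \<inter> S \<subseteq> {p v}"
    and "w \<in> edge u v" "w \<in> inside S" "w \<noteq> p v"
  shows "edge u v - {p v} \<subseteq> inside S"
proof -
  obtain c where "arc c" "pathstart c = p u" "pathfinish c = p v" "path_image c = edge u v"
    using oriented_edge assms by metis
  then show ?thesis using inside_along_path[of c S w] assms by simp
qed

lemma edge_Int_triangle:
  assumes "{x, y, z, u, v} \<subseteq> V" "distinct [x, y, z, u]" "u \<noteq> v"
  shows "edge u v \<inter> triangle x y z \<subseteq> {p v}"
proof -
  have avoid: "edge u v \<inter> edge r s \<subseteq> {p v}"
    if "r \<in> V" "s \<in> V" "r \<noteq> s" "r \<noteq> u" "s \<noteq> u" for r s
  proof -
    have "{u, v} \<noteq> {r, s}" using that by blast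
    then have "edge u v \<inter> edge r s = p ` ({u, v} \<inter> {r, s})"
      using that assms by (intro edge_Int_edge) auto
    then show ?thesis using that by auto
  qed
  have "edge u v \<inter> edge x y \<subseteq> {p v}" "edge u v \<inter> edge y z \<subseteq> {p v}"
       "edge u v \<inter> edge z x \<subseteq> {p v}"
    using assms by (intro avoid; auto)+
  then show ?thesis by blast
qed

text \<open>
  The edge from \<open>u\<close> to \<open>v\<close> avoids the triangle, so it cannot change sides.
\<close>

lemma same_side_of_triangle:
  assumes "{x, y, z, u, v} \<subseteq> V" "distinct [x, y, z, u, v]" "p u \<in> inside (triangle x y z)"
  shows "p v \<in> inside (triangle x y z)"
proof -
  have "p v \<notin> edge r s" if "r \<in> V" "s \<in> V" "r \<noteq> s" "r \<noteq> v" "s \<noteq> v" for r s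
    using vertex_on_edge[of r s v] that assms by auto
  then have "p v \<notin> edge x y" "p v \<notin> edge y z" "p v \<notin> edge z x" using assms by auto
  then have pv: "p v \<notin> triangle x y z" by blast
  have "edge u v \<inter> triangle x y z \<subseteq> {p v}"
    using edge_Int_triangle assms by simp
  with pv have dis: "edge v u \<inter> triangle x y z = {}" using edge_commute[of u v] by auto
  obtain c where c: "arc c" "pathstart c = p u" "pathfinish c = p v" "path_image c = edge u v"
    using oriented_edge[of u v] assms by auto
  have "connected (edge u v)" using c by (metis arc_imp_path connected_path_image)
  moreover have "p u \<in> edge u v" "p v \<in> edge u v" using ends_in_edge assms by auto
  ultimately have "connected_component (- triangle x y z) (p u) (p v)"
    using dis edge_commute[of u v] unfolding connected_component_def by blast
  then show ?thesis using assms(3) inside_same_component by blast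
qed

lemma compact_triangle:
  assumes "{x, y, z} \<subseteq> V" "distinct [x, y, z]"
  shows "compact (triangle x y z)"
  using assms by (intro compact_Un compact_edge) auto

text \<open>
  Suppose that \<open>d\<close> is inside the triangle \<open>abc\<close>. Then so is \<open>e\<close>. By the theta-curve theorem, the path \<open>adb\<close>
  splits the inside of \<open>abc\<close> into the insides of \<open>abd\<close> and of the quadrilateral \<open>acbd\<close>, and the edge \<open>cd\<close>
  splits the latter into the insides of \<open>acd\<close> and \<open>bcd\<close>. So \<open>e\<close> lies inside one of the three small
  triangles. The remaining corner of \<open>abc\<close> is on the same side of this triangle as \<open>e\<close>, hence inside it
  and therefore inside \<open>abc\<close>. This is absurd, because it lies on \<open>abc\<close>.
\<close>

lemma no_vertex_inside_triangle:
  assumes V: "{a, b, c, d, e} \<subseteq> V" and dist: "distinct [a, b, c, d, e]"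
  shows "p d \<notin> inside (triangle a b c)"
proof
  assume d: "p d \<in> inside (triangle a b c)"
  let ?Q = "(edge a c \<union> edge c b) \<union> (edge a d \<union> edge d b)"
  have p_neq: "p a \<noteq> p b" "p c \<noteq> p d" using p_eq_iff V dist by auto
  have neq: "b \<noteq> a" "c \<noteq> a" "d \<noteq> a" "c \<noteq> b" "d \<noteq> b" "d \<noteq> c" using dist by auto
  have comm: "edge b a = edge a b" "edge c a = edge a c" "edge c b = edge b c" "edge d a = edge a d"
    "edge d b = edge b d" "edge d c = edge c d"
    using edge_commute by metis+
  have meet1: "edge r s \<inter> edge s t = {p s}" if "{r, s, t} \<subseteq> V" "distinct [r, s, t]" for r s t
  proof -
    have "{r, s} \<noteq> {s, t}" "{r, s} \<inter> {s, t} = {s}" using that by auto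
    then show ?thesis using edge_Int_edge[of r s s t] that by simp
  qed
  have meet0: "edge r s \<inter> edge t u = {}" if "{r, s, t, u} \<subseteq> V" "distinct [r, s, t, u]" for r s t u
  proof -
    have "{r, s} \<noteq> {t, u}" "{r, s} \<inter> {t, u} = {}" using that by auto
    then show ?thesis using edge_Int_edge[of r s t u] that by simp
  qed
  have on_abc: "p a \<in> triangle a b c" "p b \<in> triangle a b c" "p c \<in> triangle a b c"
    using ends_in_edge V dist by auto
  have from_e: "p w \<in> inside (triangle x y z)"
    if "p e \<in> inside (triangle x y z)" "{x, y, z, w} \<subseteq> {a, b, c, d}" "distinct [x, y, z, w]" for x y z w
    using same_side_of_triangle[of x y z e w] that V dist by auto
  have e: "p e \<in> inside (triangle a b c)"
    using same_side_of_triangle[of a b c d e] d V dist by auto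
  obtain ab where ab: "arc ab" "pathstart ab = p a" "pathfinish ab = p b" "path_image ab = edge a b"
    using oriented_edge[of a b] V dist by auto
  obtain acb where acb: "arc acb" "pathstart acb = p a" "pathfinish acb = p b"
      "path_image acb = edge a c \<union> edge c b"
    using detour[of a c b] V dist by auto
  obtain adb where adb: "arc adb" "pathstart adb = p a" "pathfinish adb = p b"
      "path_image adb = edge a d \<union> edge d b"
    using detour[of a d b] V dist by auto
  have m: "edge a b \<inter> edge a c = {p a}" "edge a b \<inter> edge b c = {p b}" "edge a b \<inter> edge a d = {p a}"
    "edge a b \<inter> edge b d = {p b}" "edge a c \<inter> edge b c = {p c}" "edge a c \<inter> edge a d = {p a}"
    "edge a c \<inter> edge b d = {}" "edge b c \<inter> edge a d = {}" "edge b c \<inter> edge b d = {p b}"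
    "edge a d \<inter> edge b d = {p d}" "edge a c \<inter> edge c d = {p c}" "edge b c \<inter> edge c d = {p c}"
    "edge a d \<inter> edge c d = {p d}" "edge b d \<inter> edge c d = {p d}"
    using meet1[of b a c] meet1[of a b c] meet1[of b a d] meet1[of a b d] meet1[of a c b] meet1[of c a d]
      meet0[of a c b d] meet0[of b c a d] meet1[of c b d] meet1[of a d b] meet1[of a c d] meet1[of b c d]
      meet1[of a d c] meet1[of b d c] V dist neq by (simp_all add: comm)
  have theta: "path_image ab \<inter> path_image acb = {p a, p b}" "path_image ab \<inter> path_image adb = {p a, p b}"
    "path_image acb \<inter> path_image adb = {p a, p b}"
    unfolding ab acb adb comm Int_Un_distrib Int_Un_distrib2 m by auto
  have abc_eq: "path_image ab \<union> path_image acb = triangle a b c"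
    unfolding ab acb comm by blast
  have "p d \<in> path_image adb" unfolding adb using ends_in_edge[of a d] V dist by simp
  then have "path_image adb \<inter> inside (path_image ab \<union> path_image acb) \<noteq> {}"
    using d unfolding abc_eq by blast
  then have split: "inside (path_image ab \<union> path_image adb) \<union> inside (path_image acb \<union> path_image adb)
      \<union> (path_image adb - {p a, p b}) = inside (triangle a b c)"
    using split_inside_simple_closed_curve[of ab "p a" "p b" acb adb]
      ab acb adb p_neq theta unfolding abc_eq by (metis arc_imp_simple_path)
  have abd_eq: "path_image ab \<union> path_image adb = triangle a b d"
    unfolding ab adb comm by blast
  have Q_eq: "path_image acb \<union> path_image adb = ?Q" unfolding acb adb ..
  have split1: "inside (triangle a b c) = inside (triangle a b d) \<union> inside ?Q
      \<union> (edge a d \<union> edge d b - {p a, p b})"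
    using split unfolding abd_eq Q_eq unfolding adb(4) by (rule sym)
  have not_abc: "x \<notin> inside (triangle a b c)" if "x \<in> triangle a b c" for x
    using that inside_no_overlap by blast
  have "p e \<notin> inside (triangle a b d)"
    using from_e[of a b d c] dist split1 not_abc[OF on_abc(3)] by auto
  moreover have "p e \<notin> edge r s" if "{r, s} \<subseteq> {a, b, c, d}" "r \<noteq> s" for r s
    using vertex_on_edge[of r s e] that V dist by auto
  ultimately have eQ: "p e \<in> inside ?Q"
    using e split1 dist by auto
  obtain cd where cd: "arc cd" "pathstart cd = p c" "pathfinish cd = p d" "path_image cd = edge c d"
    using oriented_edge[of c d] V dist by auto
  \<comment> \<open>The edge \<open>cd\<close> runs inside \<open>acbd\<close>: its points other than \<open>c\<close> are inside \<open>abc\<close>, and those close to \<open>c\<close> are neither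
    on nor inside \<open>abd\<close>, as \<open>c\<close> is not and the set \<open>M\<close> is closed. One such point, \<open>q\<close>, is enough
    for the theta-curve theorem.\<close>
  define M where "M = triangle a b d \<union> inside (triangle a b d)"
  have "closed (triangle a b d)"
    using compact_triangle[of a b d] V dist compact_imp_closed by auto
  then have "closed M"
    unfolding M_def union_with_inside by (simp add: open_outside closed_Compl)
  have "p c \<notin> edge r s" if "{r, s} \<subseteq> {a, b, d}" "r \<noteq> s" for r s
    using vertex_on_edge[of r s c] that V dist by auto
  then have "p c \<notin> edge a b" "p c \<notin> edge b d" "p c \<notin> edge d a" using dist by auto
  then have "p c \<notin> triangle a b d" by blast
  moreover have "p c \<notin> inside (triangle a b d)" using split1 not_abc[OF on_abc(3)] by blast
  ultimately have pcM: "p c \<notin> M" unfolding M_def by blast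
  have "\<not> cd ` {0<..<1} \<subseteq> M"
  proof
    assume sub: "cd ` {0<..<1} \<subseteq> M"
    have "continuous_on (closure {0<..<1}) cd"
      using cd(1) by (simp add: arc_def path_def)
    from image_closure_subset[OF this \<open>closed M\<close> sub]
    have "cd 0 \<in> M" by auto
    then show False using pcM cd(2) by (simp add: pathstart_def)
  qed
  then obtain t where t: "0 < t" "t < 1" "cd t \<notin> M" by (auto simp: image_subset_iff)
  define q where "q = cd t"
  have "q \<in> edge c d" unfolding q_def cd(4)[symmetric] path_image_def using t by auto
  moreover have "q \<noteq> p c" "q \<noteq> p d"
    using cd t unfolding q_def arc_def inj_on_def pathstart_def pathfinish_def
    by (metis atLeastAtMost_iff less_eq_real_def less_irrefl order_refl zero_less_one)+
  ultimately have q: "q \<in> edge c d" "q \<noteq> p c" "q \<noteq> p d" by auto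
  have "edge d c - {p c} \<subseteq> inside (triangle a b c)"
    using edge_from_inside[of d c _ "p d"] d edge_Int_triangle[of a b c d c] ends_in_edge[of d c]
      p_neq V dist by auto
  then have "q \<in> inside (triangle a b c)" using q comm by auto
  moreover have "q \<notin> edge a d \<union> edge d b" using m q comm by auto
  moreover have "q \<notin> inside (triangle a b d)" using t(3) unfolding M_def q_def by blast
  ultimately have qQ: "q \<in> inside ?Q" using split1 by blast
  obtain cad where cad: "arc cad" "pathstart cad = p c" "pathfinish cad = p d"
      "path_image cad = edge c a \<union> edge a d"
    using detour[of c a d] V dist by auto
  obtain cbd where cbd: "arc cbd" "pathstart cbd = p c" "pathfinish cbd = p d"
      "path_image cbd = edge c b \<union> edge b d"
    using detour[of c b d] V dist by auto
  have theta2: "path_image cad \<inter> path_image cbd = {p c, p d}" "path_image cad \<inter> path_image cd = {p c, p d}"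
    "path_image cbd \<inter> path_image cd = {p c, p d}"
    unfolding cad cbd cd comm Int_Un_distrib Int_Un_distrib2 m using m by auto
  have Q2: "path_image cad \<union> path_image cbd = ?Q" unfolding cad cbd comm by blast
  have "path_image cd \<inter> inside (path_image cad \<union> path_image cbd) \<noteq> {}"
    using qQ q unfolding Q2 cd by blast
  then have split: "inside (path_image cad \<union> path_image cd) \<union> inside (path_image cbd \<union> path_image cd)
      \<union> (path_image cd - {p c, p d}) = inside ?Q"
    using split_inside_simple_closed_curve[of cad "p c" "p d" cbd cd]
      cad cbd cd p_neq theta2 unfolding Q2 by (metis arc_imp_simple_path)
  have acd_eq: "path_image cad \<union> path_image cd = triangle a c d"
    and bcd_eq: "path_image cbd \<union> path_image cd = triangle b c d"
    unfolding cad cbd cd comm by blast+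
  have split2: "inside ?Q = inside (triangle a c d) \<union> inside (triangle b c d)
      \<union> (edge c d - {p c, p d})"
    using split unfolding acd_eq bcd_eq unfolding cd(4) by (rule sym)
  have "p e \<notin> inside (triangle a c d)"
    using from_e[of a c d b] dist split1 split2 not_abc[OF on_abc(2)] by auto
  moreover have "p e \<notin> inside (triangle b c d)"
    using from_e[of b c d a] dist split1 split2 not_abc[OF on_abc(1)] by auto
  moreover have "p e \<notin> edge c d" using vertex_on_edge[of c d e] V dist by auto
  ultimately show False using eQ split2 by blast
qed

text \<open>
  The convention \<open>1 / 0 = 0\<close> makes the inversion injective on the whole plane. Continuity is needed on
  the edges only, and these avoid the centre.
\<close>

lemma complete_drawing_inversion:
  assumes avoid: "\<And>x y. x \<in> V \<Longrightarrow> y \<in> V \<Longrightarrow> x \<noteq> y \<Longrightarrow> z \<notin> edge x y"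
  defines "f \<equiv> \<lambda>w. 1 / (w - z)"
  shows "complete_drawing V (f \<circ> p) (\<lambda>e. f \<circ> g e)"
proof
  let ?E = "snd (complete_graph V)"
  have inj: "inj f" unfolding f_def inj_def by auto
  have zE: "z \<notin> path_image (g e)" if "e \<in> ?E" for e
    using that avoid unfolding complete_graph_def edge_def by auto
  have arcs: "arc (f \<circ> g e)" if "e \<in> ?E" for e
  proof -
    have "arc (g e)" using drawing that by (simp add: plane_drawing_def)
    moreover have "continuous_on (path_image (g e)) f"
      unfolding f_def using zE[OF that] by (intro continuous_intros) auto
    ultimately show ?thesis
      unfolding arc_def using inj
      by (auto intro!: path_continuous_image comp_inj_on inj_on_subset[OF inj])
  qed
  have img: "path_image (f \<circ> g e) = f ` path_image (g e)" for e
    by (rule path_image_compose)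
  have ends: "{pathstart (f \<circ> g e), pathfinish (f \<circ> g e)} = f ` p ` e" if "e \<in> ?E" for e
  proof -
    have "{pathstart (g e), pathfinish (g e)} = p ` e"
      using drawing that by (simp add: plane_drawing_def)
    then have "f ` {pathstart (g e), pathfinish (g e)} = f ` p ` e" by simp
    then show ?thesis by (simp add: pathstart_compose pathfinish_compose)
  qed
  have image_disjoint: "(f ` A - f ` B) \<inter> f ` C = {} \<longleftrightarrow> (A - B) \<inter> C = {}" for A B C
    unfolding image_set_diff[OF inj, symmetric] image_Int[OF inj, symmetric] by blast
  have "inj_on p V" using drawing by (simp add: plane_drawing_def complete_graph_def)
  then have "inj_on (f \<circ> p) (fst (complete_graph V))"
    using comp_inj_on[of p V f] inj_on_subset[OF inj subset_UNIV] by (simp add: complete_graph_def)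
  then show "plane_drawing (complete_graph V) (f \<circ> p) (\<lambda>e. f \<circ> g e)"
    unfolding plane_drawing_def img image_comp[symmetric] image_disjoint
    using arcs ends drawing[unfolded plane_drawing_def] by simp
qed

end

text \<open>
  By the previous lemmas \<open>d\<close> and \<open>e\<close> are outside the triangle \<open>abc\<close>. Inversion at a point \<open>z\<close> inside the
  triangle gives another drawing of the complete graph, in which \<open>d\<close> is inside \<open>abc\<close>. For this \<open>z\<close> must be
  off every edge. An edge that is not a side of \<open>abc\<close> ends at \<open>d\<close> or \<open>e\<close>, and so none of it is inside.
\<close>

lemma no_complete_drawing_5:
  assumes V: "{a, b, c, d, e} \<subseteq> V" and dist: "distinct [a, b, c, d, e]"
  shows "\<not> complete_drawing V p g"
proof
  assume "complete_drawing V p g"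
  have "plane_drawing (complete_graph {a, b, c, d, e}) p g"
  proof -
    have "snd (complete_graph {a, b, c, d, e}) \<subseteq> snd (complete_graph V)"
      "fst (complete_graph {a, b, c, d, e}) \<subseteq> fst (complete_graph V)"
      using complete_graph_mono[OF V] V by (simp_all add: complete_graph_def)
    moreover have "plane_drawing (complete_graph V) p g"
      using \<open>complete_drawing V p g\<close> by (simp add: complete_drawing_def)
    ultimately show ?thesis by (rule plane_drawing_subgraph)
  qed
  then interpret K: complete_drawing "{a, b, c, d, e}" p g by (rule complete_drawing.intro)
  let ?T = "K.triangle a b c"
  obtain ab where ab: "arc ab" "pathstart ab = p a" "pathfinish ab = p b" "path_image ab = K.edge a b"
    using K.oriented_edge[of a b] dist by auto
  obtain bca where bca: "arc bca" "pathstart bca = p b" "pathfinish bca = p a"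
      "path_image bca = K.edge b c \<union> K.edge c a"
    using K.detour[of b c a] dist by auto
  have "K.edge a b \<inter> K.edge b c \<subseteq> {p a, p b}" "K.edge a b \<inter> K.edge c a \<subseteq> {p a, p b}"
    using K.edge_Int_edge[of a b b c] K.edge_Int_edge[of a b c a] dist by (auto simp: doubleton_eq_iff)
  then have "path_image ab \<inter> path_image bca \<subseteq> {pathstart ab, pathstart bca}"
    using ab bca by auto
  then have "simple_path (ab +++ bca)"
    using ab bca by (intro simple_path_join_loop) auto
  then have "inside (path_image (ab +++ bca)) \<noteq> {}"
    using Jordan_inside_outside ab bca by simp
  moreover have "path_image (ab +++ bca) = ?T"
    using ab bca by (simp add: path_image_join Un_assoc)
  ultimately obtain z where z: "z \<in> inside ?T" by auto
  \<comment> \<open>Seen from an end in \<open>{d, e}\<close>, an edge meets the triangle in its other end at most. If it passed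
    through \<open>z\<close>, then it would start inside the triangle.\<close>
  have z_edge: "z \<notin> K.edge u v"
    if u: "u \<in> {d, e}" and v: "v \<in> {a, b, c, d, e}" "u \<noteq> v" for u v
  proof
    assume zuv: "z \<in> K.edge u v"
    have u_out: "p u \<notin> inside ?T"
      using K.no_vertex_inside_triangle[of a b c d e] K.no_vertex_inside_triangle[of a b c e d] u dist by auto
    have meet: "K.edge u v \<inter> ?T \<subseteq> {p v}"
      using K.edge_Int_triangle[of a b c u v] u v dist by auto
    have on: "p w \<in> ?T" if "w \<in> {a, b, c}" for w
      using that K.ends_in_edge[of a b] K.ends_in_edge[of b c] dist by auto
    have v_out: "p v \<notin> inside ?T"
    proof (cases "v \<in> {a, b, c}")
      case True
      then show ?thesis using on inside_no_overlap by blast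
    next
      case False
      then show ?thesis
        using K.no_vertex_inside_triangle[of a b c d e] K.no_vertex_inside_triangle[of a b c e d] v dist
        by auto
    qed
    have "z \<noteq> p v" using z v_out by auto
    with z zuv have "K.edge u v - {p v} \<subseteq> inside ?T"
      using K.edge_from_inside[of u v ?T z] meet u v by auto
    moreover have "p u \<in> K.edge u v - {p v}"
      using K.ends_in_edge[of u v] K.p_eq_iff[of u v] u v by auto
    ultimately show False using u_out by blast
  qed
  have z_avoid: "z \<notin> K.edge u v" if "u \<in> {a, b, c, d, e}" "v \<in> {a, b, c, d, e}" "u \<noteq> v" for u v
  proof (cases "u \<in> {d, e} \<or> v \<in> {d, e}")
    case True
    then show ?thesis using z_edge that K.edge_commute by metis
  next
    case False
    then have "K.edge u v \<subseteq> ?T" using that K.edge_commute by auto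
    then show ?thesis using z inside_no_overlap by blast
  qed
  define f where "f = (\<lambda>w. 1 / (w - z))"
  interpret L: complete_drawing "{a, b, c, d, e}" "f \<circ> p" "\<lambda>e. f \<circ> g e"
    unfolding f_def by (rule K.complete_drawing_inversion) (fact z_avoid)
  have "L.edge x y = f ` K.edge x y" for x y
    unfolding L.edge_def K.edge_def by (rule path_image_compose)
  then have "L.triangle a b c = f ` ?T" by blast
  moreover have "p d \<in> outside ?T"
  proof -
    have "p d \<notin> K.edge a b" "p d \<notin> K.edge b c" "p d \<notin> K.edge c a"
      using K.vertex_on_edge[of a b d] K.vertex_on_edge[of b c d] K.vertex_on_edge[of c a d] dist by auto
    then show ?thesis
      using K.no_vertex_inside_triangle[of a b c d e] dist inside_Un_outside[of ?T] by blast
  qed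
  then have "f (p d) \<in> inside (f ` ?T)"
    unfolding f_def using inversion_outside_to_inside[OF _ z] K.compact_triangle[of a b c] dist by auto
  ultimately have "(f \<circ> p) d \<in> inside (L.triangle a b c)" by simp
  then show False using L.no_vertex_inside_triangle[of a b c d e] dist by blast
qed

lemma nonplanar_if_clique5:
  assumes W: "W \<subseteq> fst \<Gamma>" "card W = 5"
    and adj: "\<And>x y. x \<in> W \<Longrightarrow> y \<in> W \<Longrightarrow> x \<noteq> y \<Longrightarrow> {x, y} \<in> snd \<Gamma>"
  shows "\<not> planar \<Gamma>"
proof
  assume "planar \<Gamma>"
  then obtain p g where draw: "plane_drawing \<Gamma> p g" by (auto simp: planar_def)
  have "finite W" using W(2) by (intro card_ge_0_finite) simp
  then obtain vs where vs: "set vs = W" "distinct vs" using finite_distinct_list by blast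
  then have "length vs = Suc (Suc (Suc (Suc (Suc 0))))" using W(2) distinct_card by fastforce
  then obtain a b c d e where abcde: "vs = [a, b, c, d, e]" by (auto simp: length_Suc_conv)
  have "complete_drawing W p g"
  proof (intro complete_drawing.intro plane_drawing_subgraph[OF _ _ draw])
    show "fst (complete_graph W) \<subseteq> fst \<Gamma>" using W(1) by (simp add: complete_graph_def)
    show "snd (complete_graph W) \<subseteq> snd \<Gamma>"
      using adj unfolding complete_graph_def snd_conv by blast
  qed
  then show False using no_complete_drawing_5[of a b c d e W p g] vs abcde by auto
qed

section \<open>Graphs with at most four vertices are planar\<close>

text \<open>
  The origin and three points around it: the segments between them draw the complete graph on four
  vertices.
\<close>

definition K4_points :: "complex set" where
  "K4_points = {0, 1, \<i>, - 1 - \<i>}"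

text \<open>
  Barycentric coordinates of the plane relative to the four points. The plane is the union of the three
  cones spanned by two of the vectors \<open>1\<close>, \<open>\<i>\<close>, \<open>- 1 - \<i>\<close>, so each \<open>z\<close> is a nonnegative combination of these
  in which some coefficient vanishes. These coefficients are the weights of the three points, and the
  weight of \<open>0\<close> makes the total equal to \<open>1\<close>.
\<close>

definition K4_weight :: "complex \<Rightarrow> complex \<Rightarrow> real" where
  "K4_weight z P = (let c = max 0 (max (- Re z) (- Im z)) in
    if P = 0 then 1 - Re z - Im z - 3 * c
    else if P = 1 then Re z + c
    else if P = \<i> then Im z + c
    else c)"

lemma K4_points_distinct:
  "0 \<noteq> \<i>" "1 \<noteq> \<i>" "0 \<noteq> - 1 - \<i>" "1 \<noteq> - 1 - \<i>" "\<i> \<noteq> - 1 - \<i>"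
  by (simp_all add: complex_eq_iff)

text \<open>
  The weights are affine on each segment between two of the points, since it lies in one of the cones. At
  the four points themselves, the weight of \<open>P\<close> vanishes except at \<open>P\<close>.
\<close>

lemma K4_weight_eq_0:
  assumes XY: "X \<in> K4_points" "Y \<in> K4_points" and z: "z \<in> closed_segment X Y"
    and P: "P \<in> K4_points" "P \<noteq> X" "P \<noteq> Y"
  shows "K4_weight z P = 0"
proof -
  obtain u where u: "0 \<le> u" "u \<le> 1" and z_eq: "z = (1 - u) *\<^sub>R X + u *\<^sub>R Y"
    using z by (auto simp: in_segment)
  have "Re z = (1 - u) * Re X + u * Re Y" "Im z = (1 - u) * Im X + u * Im Y"
    unfolding z_eq by simp_all
  then show ?thesis
    using XY P u K4_points_distinct unfolding K4_points_def K4_weight_def Let_def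
    by (elim insertE emptyE; simp add: max_def)
qed

lemma K4_barycentric:
  "(\<Sum>P\<in>K4_points. K4_weight z P) = 1" "(\<Sum>P\<in>K4_points. K4_weight z P *\<^sub>R P) = z"
  using K4_points_distinct unfolding K4_points_def
  by (simp_all add: K4_weight_def Let_def complex_eq_iff algebra_simps)

text \<open>
  A common point of both segments has nonzero weight at common ends only, and there is at most one
  common end. As the weights add up to \<open>1\<close>, the point is this end.
\<close>

lemma K4_segments_meet_at_ends:
  assumes K: "X \<in> K4_points" "Y \<in> K4_points" "U \<in> K4_points" "V \<in> K4_points"
    and neq: "X \<noteq> Y" "U \<noteq> V" "{X, Y} \<noteq> {U, V}"
    and z: "z \<in> closed_segment X Y" "z \<in> closed_segment U V"
  shows "z \<in> {X, Y} \<inter> {U, V}"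
proof -
  let ?T = "{X, Y} \<inter> {U, V}"
  have fin: "finite K4_points" by (simp add: K4_points_def)
  have sub: "?T \<subseteq> K4_points" using K by blast
  have zero: "\<forall>P \<in> K4_points - ?T. K4_weight z P = 0"
    using K4_weight_eq_0[OF K(1,2) z(1)] K4_weight_eq_0[OF K(3,4) z(2)] by blast
  have "(\<Sum>P\<in>?T. K4_weight z P) = (\<Sum>P\<in>K4_points. K4_weight z P)"
    by (rule sum.mono_neutral_left[OF fin sub zero])
  then have sum1: "(\<Sum>P\<in>?T. K4_weight z P) = 1" unfolding K4_barycentric .
  have "(\<Sum>P\<in>?T. K4_weight z P *\<^sub>R P) = (\<Sum>P\<in>K4_points. K4_weight z P *\<^sub>R P)"
    by (rule sum.mono_neutral_left[OF fin sub]) (simp add: zero)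
  then have sum2: "(\<Sum>P\<in>?T. K4_weight z P *\<^sub>R P) = z" unfolding K4_barycentric .
  have "?T \<noteq> {}"
  proof
    assume "?T = {}"
    then show False using sum1 unfolding \<open>?T = {}\<close> by simp
  qed
  then obtain P where P: "?T = {P}" using neq by blast
  have "K4_weight z P = 1" "K4_weight z P *\<^sub>R P = z" using sum1 sum2 unfolding P by simp_all
  then show ?thesis unfolding P by simp
qed

lemma planar_if_at_most_4_vertices:
  assumes V: "finite (fst \<Gamma>)" "card (fst \<Gamma>) \<le> 4"
    and E: "snd \<Gamma> \<subseteq> {{x, y} | x y. x \<in> fst \<Gamma> \<and> y \<in> fst \<Gamma> \<and> x \<noteq> y}"
  shows "planar \<Gamma>"
proof -
  let ?V = "fst \<Gamma>"
  let ?K = K4_points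
  have "card ?K = 4" "finite ?K" by (simp_all add: K4_points_def complex_eq_iff)
  then obtain p where p: "p ` ?V \<subseteq> ?K" "inj_on p ?V"
    using card_le_inj[of ?V ?K] V by auto
  \<comment> \<open>A straight segment for every edge; the choice only fixes its direction.\<close>
  define g where "g e = (SOME c. \<exists>u v. c = linepath u v \<and> {u, v} = p ` e)" for e
  have edge: "\<exists>x y. x \<in> ?V \<and> y \<in> ?V \<and> x \<noteq> y \<and> e = {x, y} \<and> g e = linepath (p x) (p y)"
    if e: "e \<in> snd \<Gamma>" for e
  proof -
    obtain x y where xy: "e = {x, y}" "x \<in> ?V" "y \<in> ?V" "x \<noteq> y" using E e by blast
    have "\<exists>c u v. c = linepath u v \<and> {u, v} = p ` e" using xy(1) by auto
    from someI_ex[OF this] obtain u v where uv: "g e = linepath u v" "{u, v} = p ` e"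
      unfolding g_def by blast
    then consider "u = p x" "v = p y" | "u = p y" "v = p x"
      using xy(1) by (auto simp: doubleton_eq_iff)
    then show ?thesis
    proof cases
      case 1
      then show ?thesis using xy uv by blast
    next
      case 2
      then show ?thesis using xy uv by (metis insert_commute)
    qed
  qed
  have "plane_drawing \<Gamma> p g"
    unfolding plane_drawing_def
  proof (intro conjI ballI impI)
    show "inj_on p ?V" by (rule p(2))
    fix e assume "e \<in> snd \<Gamma>"
    from edge[OF this] obtain x y where
      e: "x \<in> ?V" "y \<in> ?V" "x \<noteq> y" "e = {x, y}" "g e = linepath (p x) (p y)" by blast
    have neq: "p x \<noteq> p y" using p(2) e by (simp add: inj_on_eq_iff)
    have K: "p v \<in> ?K" if "v \<in> ?V" for v using p(1) that by blast
    show "arc (g e)" "{pathstart (g e), pathfinish (g e)} = p ` e" using e neq by simp_all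
    have vertex: "p v \<in> p ` e" if "p v \<in> path_image (g e)" "v \<in> ?V" for v
    proof (rule ccontr)
      assume "p v \<notin> p ` e"
      then have "p v \<noteq> p x" "p v \<noteq> p y" using e(4) by auto
      then have "p v \<in> {p x, p y} \<inter> {p x, p v}"
        using K4_segments_meet_at_ends[of "p x" "p y" "p x" "p v" "p v"] K that e neq
        by (auto simp: doubleton_eq_iff)
      then show False using \<open>p v \<noteq> p x\<close> \<open>p v \<noteq> p y\<close> by blast
    qed
    then show "(path_image (g e) - p ` e) \<inter> p ` ?V = {}" by blast
    fix d assume "d \<in> snd \<Gamma>" and ed: "e \<noteq> d"
    from edge[OF this(1)] obtain u v where
      d: "u \<in> ?V" "v \<in> ?V" "u \<noteq> v" "d = {u, v}" "g d = linepath (p u) (p v)" by blast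
    have "p u \<noteq> p v" using p(2) d by (simp add: inj_on_eq_iff)
    moreover have "{p x, p y} \<noteq> {p u, p v}"
      using ed e d p(2) by (auto simp: doubleton_eq_iff inj_on_eq_iff)
    ultimately have "z \<in> {p x, p y}" if "z \<in> path_image (g e)" "z \<in> path_image (g d)" for z
      using K4_segments_meet_at_ends[OF K[OF e(1)] K[OF e(2)] K[OF d(1)] K[OF d(2)] neq, of z] that e d
      by auto
    then show "(path_image (g e) - p ` e) \<inter> path_image (g d) = {}" using e(4) by blast
  qed
  then show ?thesis unfolding planar_def by blast
qed

section \<open>Elements of maximal order in abelian groups\<close>

context comm_group
begin

lemma subgroup_Union_chain:
  assumes "C \<noteq> {}" "subset.chain {H. subgroup H G} C"
  shows "subgroup (\<Union>C) G"
proof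
  have sub: "subgroup H G" if "H \<in> C" for H
    using assms(2) that by (auto simp: subset_chain_def)
  show "\<Union>C \<subseteq> carrier G" using sub subgroup.subset by blast
  show "\<one> \<in> \<Union>C" using assms(1) sub subgroup.one_closed by fastforce
  show "inv x \<in> \<Union>C" if "x \<in> \<Union>C" for x
    using that sub subgroup.m_inv_closed by fastforce
  fix x y assume "x \<in> \<Union>C" "y \<in> \<Union>C"
  then obtain H K where HK: "H \<in> C" "K \<in> C" "x \<in> H" "y \<in> K" by blast
  then have "H \<subseteq> K \<or> K \<subseteq> H" using assms(2) by (auto simp: subset_chain_def)
  then obtain L where "L \<in> C" "x \<in> L" "y \<in> L" using HK by blast
  then show "x \<otimes> y \<in> \<Union>C" using sub subgroup.m_closed by fast
qed

lemma mem_subgroup_mult_powers: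
  assumes "subgroup H G" "x \<in> carrier G"
  shows "g \<in> H <#> generate G {x} \<longleftrightarrow> (\<exists>h\<in>H. \<exists>k::int. g = h \<otimes> x [^] k)"
  using generate_pow[OF assms(2)] by (auto simp: set_mult_def)

lemma subgroup_mult_powers:
  assumes "subgroup H G" "x \<in> carrier G"
  shows "subgroup (H <#> generate G {x}) G"
  using assms by (intro mult_subgroups generate_is_subgroup) auto

text \<open>
  The exponents \<open>i\<close> with \<open>g [^] i \<in> P\<close> form an ideal of the integers; \<open>m\<close> is its positive generator.
\<close>

lemma least_power_in_subgroup:
  fixes n :: nat
  assumes P: "subgroup P G" and g: "g \<in> carrier G" and n: "n > 0" "g [^] n \<in> P"
  obtains m :: nat where "m > 0" "g [^] m \<in> P" "\<And>i::int. g [^] i \<in> P \<Longrightarrow> int m dvd i"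
proof -
  define m :: nat where "m = (LEAST m. m > 0 \<and> g [^] m \<in> P)"
  have "n > 0 \<and> g [^] n \<in> P" using n by simp
  then have m: "m > 0 \<and> g [^] m \<in> P" unfolding m_def by (rule LeastI)
  have m_dvd: "int m dvd i" if i: "g [^] i \<in> P" for i :: int
  proof -
    define r where "r = nat (i mod int m)"
    have r: "int r = i mod int m" "r < m" unfolding r_def using m by (simp_all add: nat_less_iff)
    have "int r = i + int m * (- (i div int m))" unfolding r(1) by (simp flip: minus_mult_div_eq_mod)
    then have "g [^] int r = g [^] i \<otimes> (g [^] int m) [^] (- (i div int m))"
      using g by (simp only: int_pow_mult int_pow_pow)
    then have "g [^] r = g [^] i \<otimes> (g [^] m) [^] (- (i div int m))"
      by (simp only: int_pow_int)
    also have "\<dots> \<in> P"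
      using subgroup.m_closed[OF P i subgroup_int_pow_closed[OF P conjunct2[OF m]]] .
    finally have "g [^] r \<in> P" .
    moreover have "\<not> (r > 0 \<and> g [^] r \<in> P)"
      using r(2) not_less_Least[of r "\<lambda>m. m > 0 \<and> g [^] m \<in> P"] unfolding m_def by simp
    ultimately have "r = 0" by simp
    then have "i mod int m = 0" unfolding r(1)[symmetric] by simp
    then show ?thesis by (rule mod_0_imp_dvd)
  qed
  show thesis by (rule that[OF conjunct1[OF m] conjunct2[OF m] m_dvd])
qed

text \<open>
  A cyclic subgroup whose order is the exponent of the group is a direct factor. By Zorn's lemma there
  is a maximal subgroup \<open>H\<close> that meets \<open>\<langle>x\<rangle>\<close> trivially. Let \<open>g\<close> be an element outside \<open>H\<langle>x\<rangle>\<close>, and let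
  \<open>m\<close> generate the exponents that take \<open>g\<close> into \<open>H\<langle>x\<rangle>\<close>, so that \<open>g [^] m = h \<otimes> x [^] j\<close>. Here \<open>m\<close>
  divides \<open>n\<close>, and the \<open>n\<close>-th power of \<open>g\<close> being trivial forces \<open>m\<close> to divide \<open>j\<close>. So \<open>g\<close> can be corrected by a
  power of \<open>x\<close> to an element \<open>g'\<close> with \<open>g' [^] m \<in> H\<close>. Adjoining \<open>g'\<close> to \<open>H\<close> contradicts maximality.
\<close>

lemma cyclic_complement:
  fixes n :: nat
  assumes n: "n > 0" and exponent: "\<And>g. g \<in> carrier G \<Longrightarrow> g [^] n = \<one>"
    and x: "x \<in> carrier G" and order: "\<And>k::int. x [^] k = \<one> \<Longrightarrow> int n dvd k"
  obtains H where "subgroup H G" "\<And>k::int. x [^] k \<in> H \<Longrightarrow> int n dvd k"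
    "\<And>g. g \<in> carrier G \<Longrightarrow> \<exists>h\<in>H. \<exists>k::int. g = h \<otimes> x [^] k"
proof -
  define A where "A = {H. subgroup H G \<and> (\<forall>k::int. x [^] k \<in> H \<longrightarrow> int n dvd k)}"
  have "{\<one>} \<in> A" using triv_subgroup order by (auto simp: A_def)
  moreover have "\<Union>C \<in> A" if "C \<noteq> {}" "subset.chain A C" for C
  proof -
    have "subset.chain {H. subgroup H G} C" using that(2) by (auto simp: subset_chain_def A_def)
    with that show ?thesis
      using subgroup_Union_chain[of C] by (fastforce simp: A_def subset_chain_def)
  qed
  ultimately obtain H where H: "H \<in> A" and max: "\<And>K. K \<in> A \<Longrightarrow> H \<subseteq> K \<Longrightarrow> K = H"
    using subset_Zorn_nonempty[of A] by blast
  have subH: "subgroup H G" and Hx: "\<And>k::int. x [^] k \<in> H \<Longrightarrow> int n dvd k"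
    using H by (auto simp: A_def)
  let ?P = "H <#> generate G {x}"
  note mem_P = mem_subgroup_mult_powers[OF subH x]
  have subP: "subgroup ?P G" using subgroup_mult_powers[OF subH x] .
  have H_carrier: "h \<in> carrier G" if "h \<in> H" for h using that subH subgroup.mem_carrier by fast
  have H_P: "h \<in> ?P" if "h \<in> H" for h
    using that H_carrier unfolding mem_P by (intro bexI[of _ h] exI[of _ 0]) auto
  have x_P: "x [^] k \<in> ?P" for k :: int
    using x subgroup.one_closed[OF subH] unfolding mem_P by (intro bexI[of _ \<one>] exI[of _ k]) auto
  have "g \<in> ?P" if g: "g \<in> carrier G" for g
  proof (rule ccontr)
    assume gP: "g \<notin> ?P"
    have "g [^] n \<in> ?P" using exponent[OF g] subgroup.one_closed[OF subP] by simp
    then obtain m :: nat where m: "m > 0" "g [^] m \<in> ?P" and m_dvd: "\<And>i::int. g [^] i \<in> ?P \<Longrightarrow> int m dvd i"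
      using least_power_in_subgroup[OF subP g n] by blast
    obtain h j where hj: "h \<in> H" "g [^] m = h \<otimes> x [^] (j::int)" using m(2) unfolding mem_P by blast
    have hc: "h \<in> carrier G" using hj H_carrier by blast
    have "int m dvd int n"
      using m_dvd[of "int n"] exponent[OF g] subgroup.one_closed[OF subP] by (simp add: int_pow_int)
    then obtain q where q: "n = m * q" by auto
    have "\<one> = (g [^] m) [^] q" using exponent[OF g] g by (simp add: nat_pow_pow q)
    also have "\<dots> = (h \<otimes> x [^] j) [^] int q" by (simp only: hj(2) int_pow_int)
    also have "\<dots> = h [^] int q \<otimes> x [^] (j * int q)"
      using hc x by (simp only: int_pow_distrib int_pow_pow int_pow_closed)
    finally have "x [^] (j * int q) \<otimes> h [^] int q = \<one>"
      using hc x by (simp add: m_comm)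
    then have "x [^] (j * int q) = inv (h [^] int q)"
      using hc x by (intro inv_equality[symmetric]) auto
    also have "\<dots> \<in> H" using subgroup.m_inv_closed[OF subH subgroup_int_pow_closed[OF subH hj(1)]] .
    finally have "int n dvd j * int q" using Hx by blast
    then have "int m dvd j" using q n by simp
    then obtain j' where j': "j = int m * j'" by auto
    define g' where "g' = g \<otimes> x [^] (- j')"
    have g'c: "g' \<in> carrier G" using g x by (simp add: g'_def)
    have g'_pow: "g' [^] i = g [^] i \<otimes> x [^] (- j' * i)" for i :: int
      using g x by (simp only: g'_def int_pow_distrib int_pow_pow int_pow_closed)
    have g'm: "g' [^] int m = h"
    proof -
      have "g' [^] int m = (h \<otimes> x [^] j) \<otimes> x [^] (- j)"
        using g'_pow[of "int m"] hj(2) by (simp add: int_pow_int j' mult.commute)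
      then show ?thesis using hc x by (simp add: int_pow_neg m_assoc)
    qed
    let ?K = "H <#> generate G {g'}"
    note mem_K = mem_subgroup_mult_powers[OF subH g'c]
    have "int n dvd k" if k: "x [^] k \<in> ?K" for k :: int
    proof -
      obtain h' i where hi: "h' \<in> H" "x [^] k = h' \<otimes> g' [^] (i::int)" using k unfolding mem_K by blast
      have h'c: "h' \<in> carrier G" using hi H_carrier by blast
      have "g [^] i = inv h' \<otimes> x [^] (k + j' * i)"
      proof -
        have "inv h' \<otimes> x [^] (k + j' * i) = inv h' \<otimes> (h' \<otimes> g' [^] i) \<otimes> x [^] (j' * i)"
          using x h'c by (simp add: int_pow_mult hi(2)[symmetric] m_assoc)
        also have "\<dots> = g' [^] i \<otimes> x [^] (j' * i)"
          using h'c g'c by (simp add: m_assoc[symmetric])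
        also have "\<dots> = g [^] i \<otimes> (x [^] (- j' * i) \<otimes> x [^] (j' * i))"
          using g x by (simp add: g'_pow m_assoc)
        finally show ?thesis using g x by (simp add: int_pow_neg)
      qed
      also have "\<dots> \<in> ?P"
        using subgroup.m_closed[OF subP _ x_P] H_P subgroup.m_inv_closed[OF subH hi(1)] by blast
      finally obtain s where "i = int m * s" using m_dvd by blast
      then have "g' [^] i = h [^] s" using g'm g'c by (metis int_pow_pow)
      then have "g' [^] i \<in> H" using subgroup_int_pow_closed[OF subH hj(1)] by simp
      then show ?thesis using hi Hx subgroup.m_closed[OF subH] by metis
    qed
    then have "?K \<in> A" using subgroup_mult_powers[OF subH g'c] by (simp add: A_def)
    moreover have "H \<subseteq> ?K"
    proof
      fix h assume "h \<in> H"
      then show "h \<in> ?K" using H_carrier unfolding mem_K by (intro bexI[of _ h] exI[of _ 0]) auto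
    qed
    ultimately have "?K = H" using max by blast
    moreover have "g' \<in> ?K"
      using g'c subgroup.one_closed[OF subH] unfolding mem_K
      by (intro bexI[of _ \<one>] exI[of _ 1]) auto
    ultimately have "g' \<otimes> x [^] j' \<in> ?P" unfolding mem_P by auto
    moreover have "g' \<otimes> x [^] j' = g"
      using g x by (simp add: g'_def m_assoc int_pow_neg)
    ultimately show False using gP by simp
  qed
  then show thesis using that[of H] subH Hx mem_P by blast
qed

text \<open>
  Project onto \<open>\<langle>x\<rangle>\<close> along a complement \<open>H\<close>, then send \<open>x [^] k\<close> to \<open>y [^] k\<close>. The exponent \<open>k\<close> is determined
  modulo \<open>n\<close> only, which suffices since \<open>y [^] n = \<one>\<close>.
\<close>

lemma endomorphism_from_max_order:
  fixes n :: nat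
  assumes n: "n > 0" and exponent: "\<And>g. g \<in> carrier G \<Longrightarrow> g [^] n = \<one>"
    and x: "x \<in> carrier G" and order: "\<And>k::int. x [^] k = \<one> \<Longrightarrow> int n dvd k"
    and y: "y \<in> carrier G"
  shows "\<exists>f \<in> hom G G. f x = y"
proof -
  obtain H where subH: "subgroup H G" and Hx: "\<And>k::int. x [^] k \<in> H \<Longrightarrow> int n dvd k"
    and ex: "\<And>g. g \<in> carrier G \<Longrightarrow> \<exists>h\<in>H. \<exists>k::int. g = h \<otimes> x [^] k"
    using cyclic_complement[OF n exponent x order] by blast
  have H_carrier: "h \<in> carrier G" if "h \<in> H" for h using that subH subgroup.mem_carrier by fast
  define f where "f g = y [^] (SOME k::int. \<exists>h\<in>H. g = h \<otimes> x [^] k)" for g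
  have f: "f (h \<otimes> x [^] k) = y [^] k" if h: "h \<in> H" for h and k :: int
  proof -
    let ?k = "SOME i::int. \<exists>h'\<in>H. h \<otimes> x [^] k = h' \<otimes> x [^] i"
    have "\<exists>i::int. \<exists>h'\<in>H. h \<otimes> x [^] k = h' \<otimes> x [^] i" using h by blast
    from someI_ex[OF this] have k: "\<exists>h'\<in>H. h \<otimes> x [^] k = h' \<otimes> x [^] ?k" .
    define i where "i = ?k"
    obtain h' where h': "h' \<in> H" "h \<otimes> x [^] k = h' \<otimes> x [^] i" using k unfolding i_def by blast
    have "x [^] (k - i) = (inv h \<otimes> (h \<otimes> x [^] k)) \<otimes> inv (x [^] i)"
      using x H_carrier[OF h] by (simp add: int_pow_diff flip: m_assoc)
    also have "\<dots> = (inv h \<otimes> (h' \<otimes> x [^] i)) \<otimes> inv (x [^] i)" by (simp only: h'(2))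
    also have "\<dots> = inv h \<otimes> h'"
      using x H_carrier h h' by (simp add: m_assoc)
    also have "\<dots> \<in> H" using subgroup.m_closed[OF subH subgroup.m_inv_closed[OF subH h] h'(1)] .
    finally obtain s where "k - i = int n * s" using Hx by blast
    then have "k = i + int n * s" by simp
    then have "y [^] k = y [^] i \<otimes> (y [^] n) [^] s"
      using y by (simp add: int_pow_mult int_pow_pow int_pow_int[symmetric] del: int_pow_int)
    then show ?thesis using y exponent by (simp add: f_def i_def)
  qed
  have "f \<in> hom G G"
  proof (rule homI)
    show "f g \<in> carrier G" for g using y by (simp add: f_def)
    fix a b assume "a \<in> carrier G" "b \<in> carrier G"
    then obtain h k h' k' where ab: "h \<in> H" "a = h \<otimes> x [^] (k::int)" "h' \<in> H" "b = h' \<otimes> x [^] (k'::int)"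
      using ex by metis
    have "a \<otimes> b = (h \<otimes> h') \<otimes> x [^] (k + k')"
      using ab x H_carrier by (simp add: int_pow_mult m_ac)
    then have "f (a \<otimes> b) = y [^] (k + k')" using f subgroup.m_closed[OF subH ab(1,3)] by simp
    then show "f (a \<otimes> b) = f a \<otimes> f b" using f ab y by (simp add: int_pow_mult)
  qed
  moreover have "f x = y"
    using f[OF subgroup.one_closed[OF subH], of 1] x y by simp
  ultimately show ?thesis by blast
qed

end

section \<open>Cliques in the endomorphism graph\<close>

context comm_group
begin

lemma nonplanar_if_related5:
  assumes "W \<subseteq> carrier G" "card W = 5"
    and "\<And>x y. x \<in> W \<Longrightarrow> y \<in> W \<Longrightarrow> x \<noteq> y \<Longrightarrow> \<exists>f \<in> hom G G. f x = y \<or> f y = x"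
  shows "\<not> planar (endomorphism_graph G)"
proof (rule nonplanar_if_clique5[of W])
  show "W \<subseteq> fst (endomorphism_graph G)" using assms(1) by (simp add: endomorphism_graph_def)
  fix x y assume "x \<in> W" "y \<in> W" "x \<noteq> y"
  moreover from this have "\<exists>f \<in> hom G G. f x = y \<or> f y = x" by (rule assms(3))
  ultimately show "{x, y} \<in> snd (endomorphism_graph G)"
    using assms(1) unfolding endomorphism_graph_def snd_conv by blast
qed (fact assms(2))

text \<open>
  The five powers of \<open>x\<close> with exponents \<open>0\<close>, \<open>1\<close>, \<open>-1\<close>, \<open>2\<close>, \<open>-2\<close> are distinct, and of any two of these exponents
  one divides the other. So the power maps of \<open>G\<close> already make these elements pairwise adjacent.
\<close>

lemma nonplanar_if_order_gt_4:
  assumes x: "x \<in> carrier G" and order: "\<And>k::int. k \<in> {1..4} \<Longrightarrow> x [^] k \<noteq> \<one>"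
  shows "\<not> planar (endomorphism_graph G)"
proof (rule nonplanar_if_related5)
  let ?I = "{0, 1, -1, 2, -2} :: int set"
  let ?W = "(\<lambda>i. x [^] i) ` ?I"
  have less: "x [^] i \<noteq> x [^] j" if "i \<in> ?I" "j \<in> ?I" "j < i" for i j
  proof
    assume "x [^] i = x [^] j"
    then have "x [^] (i - j) = \<one>" using x by (simp add: int_pow_diff)
    moreover have "i - j \<in> {1..4}" using that by auto
    ultimately show False using order by blast
  qed
  have "inj_on (\<lambda>i. x [^] i) ?I"
    using less by (intro inj_onI) (metis linorder_neqE)
  then show "card ?W = 5" by (subst card_image) auto
  show "?W \<subseteq> carrier G" using x by blast
  have pow: "\<exists>f \<in> hom G G. f (x [^] i) = x [^] j" if "i dvd j" for i j :: int
  proof -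
    obtain k where k: "j = i * k" using \<open>i dvd j\<close> by blast
    have "(\<lambda>g. g [^] k) \<in> hom G G" by (intro homI) (auto simp: int_pow_distrib)
    moreover have "(x [^] i) [^] k = x [^] j" using x k by (simp add: int_pow_pow)
    ultimately show ?thesis by (intro bexI[of _ "\<lambda>g. g [^] k"])
  qed
  fix u v assume "u \<in> ?W" "v \<in> ?W"
  then obtain i j where ij: "i \<in> ?I" "j \<in> ?I" "u = x [^] i" "v = x [^] j" by blast
  then have "i dvd j \<or> j dvd i" by auto
  then show "\<exists>f \<in> hom G G. f u = v \<or> f v = u"
    using pow unfolding ij(3,4) by blast
qed

text \<open>
  Of two distinct members of \<open>W\<close> one is not the identity. It has order \<open>n\<close>, so some endomorphism maps it
  to the other one.
\<close>

lemma nonplanar_if_max_order: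
  fixes n :: nat
  assumes n: "n > 0" and exponent: "\<And>g. g \<in> carrier G \<Longrightarrow> g [^] n = \<one>"
    and W: "W \<subseteq> carrier G" "card W = 5"
    and order: "\<And>x (k::int). x \<in> W \<Longrightarrow> x \<noteq> \<one> \<Longrightarrow> x [^] k = \<one> \<Longrightarrow> int n dvd k"
  shows "\<not> planar (endomorphism_graph G)"
proof (rule nonplanar_if_related5[OF W])
  fix x y assume xy: "x \<in> W" "y \<in> W" "x \<noteq> y"
  have map: "\<exists>f \<in> hom G G. f u = v" if "u \<in> W" "v \<in> W" "u \<noteq> \<one>" for u v
  proof (rule endomorphism_from_max_order[OF n exponent])
    show "u \<in> carrier G" "v \<in> carrier G" using that W by blast+
    show "int n dvd k" if "u [^] k = \<one>" for k :: int
      using order \<open>u \<in> W\<close> \<open>u \<noteq> \<one>\<close> that by blast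
  qed
  show "\<exists>f \<in> hom G G. f x = y \<or> f y = x"
    using map[OF xy(1,2)] map[OF xy(2,1)] xy(3) by blast
qed

lemma dvd_if_pow_eq_one:
  fixes n :: nat
  assumes n: "n > 0" and x: "x \<in> carrier G" "x [^] n = \<one>"
    and small: "\<And>r::nat. 0 < r \<Longrightarrow> r < n \<Longrightarrow> x [^] r \<noteq> \<one>"
    and k: "x [^] (k::int) = \<one>"
  shows "int n dvd k"
proof -
  obtain m :: nat where m: "m > 0" "x [^] m \<in> {\<one>}"
    and dvd: "\<And>i::int. x [^] i \<in> {\<one>} \<Longrightarrow> int m dvd i"
    using least_power_in_subgroup[OF triv_subgroup x(1) n] x(2) by blast
  have "int m dvd int n" using dvd[of "int n"] x(2) by (simp add: int_pow_int)
  then have "m \<le> n" using n by (simp add: dvd_imp_le)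
  then have "m = n" using small[of m] m by force
  then show ?thesis using dvd k by blast
qed

text \<open>
  The elements of order \<open>4\<close> are those whose square is nontrivial. Besides \<open>a\<close> and its inverse there is
  another such element \<open>b\<close>, either \<open>g\<close> or \<open>a \<otimes> g\<close>. Together with their inverses and the identity, \<open>a\<close> and \<open>b\<close>
  form a clique.
\<close>

lemma nonplanar_if_exponent_4:
  assumes exponent: "\<And>g. g \<in> carrier G \<Longrightarrow> g [^] (4::nat) = \<one>"
    and a: "a \<in> carrier G" "a \<otimes> a \<noteq> \<one>"
    and g: "g \<in> carrier G" "g \<notin> {\<one>, a, inv a, inv (a \<otimes> a)}"
  shows "\<not> planar (endomorphism_graph G)"
proof -
  obtain b where b: "b \<in> carrier G" "b \<otimes> b \<noteq> \<one>" "b \<noteq> a" "b \<noteq> inv a"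
  proof (cases "g \<otimes> g = \<one>")
    case True
    have "(a \<otimes> g) \<otimes> (a \<otimes> g) = (a \<otimes> a) \<otimes> (g \<otimes> g)" using a g by (simp add: m_ac)
    then have "(a \<otimes> g) \<otimes> (a \<otimes> g) \<noteq> \<one>" using True a by simp
    moreover have "a \<otimes> g \<noteq> a" using a g by auto
    moreover have "a \<otimes> g \<noteq> inv a"
    proof
      assume "a \<otimes> g = inv a"
      then have "g \<otimes> (a \<otimes> a) = \<one>" using a g by (metis l_inv m_assoc m_comm)
      then show False using inv_equality[of g "a \<otimes> a"] a g by simp
    qed
    ultimately show thesis using that[of "a \<otimes> g"] a g by simp
  next
    case False
    then show thesis using that[of g] g by simp
  qed
  let ?W = "{\<one>, a, inv a, b, inv b}"
  have inv_sq: "inv u \<otimes> inv u \<noteq> \<one>" if "u \<in> carrier G" "u \<otimes> u \<noteq> \<one>" for u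
    using that by (metis inv_mult inv_one inv_inv m_closed)
  have neq_inv: "u \<noteq> inv u" if "u \<in> carrier G" "u \<otimes> u \<noteq> \<one>" for u
    using that by (metis r_inv)
  have "a \<noteq> \<one>" "b \<noteq> \<one>" "inv a \<noteq> \<one>" "inv b \<noteq> \<one>" using a b inv_sq[OF a] inv_sq[OF b(1,2)] by auto
  moreover have "a \<noteq> inv a" "b \<noteq> inv b" "a \<noteq> b" "inv a \<noteq> b" using neq_inv[OF a] neq_inv[OF b(1,2)] b by auto
  moreover have "inv a \<noteq> inv b" using a b inv_inv by metis
  moreover have "a \<noteq> inv b" using a b inv_inv by metis
  ultimately have card: "card ?W = 5" by simp
  have sq: "u \<otimes> u \<noteq> \<one>" if "u \<in> ?W" "u \<noteq> \<one>" for u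
    using that a b inv_sq by blast
  have W: "?W \<subseteq> carrier G" using a b by auto
  show ?thesis
  proof (rule nonplanar_if_max_order[OF _ exponent W card])
    fix u and k :: int assume u: "u \<in> ?W" "u \<noteq> \<one>" "u [^] k = \<one>"
    have uc: "u \<in> carrier G" using u W by blast
    show "int 4 dvd k"
    proof (rule dvd_if_pow_eq_one[OF _ uc exponent[OF uc] _ u(3)])
      fix r :: nat assume r: "0 < r" "r < 4"
      show "u [^] r \<noteq> \<one>"
      proof
        assume eq: "u [^] r = \<one>"
        have "r = 1 \<or> r = 2 \<or> r = 3" using r by auto
        then show False
        proof (elim disjE)
          assume "r = 3"
          then have "u [^] (3::nat) \<otimes> u = u" using eq uc by simp
          moreover have "u [^] (3::nat) \<otimes> u = \<one>" using exponent[OF uc] by (simp add: eval_nat_numeral)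
          ultimately show False using u by simp
        qed (use eq u sq[OF u(1,2)] uc in \<open>simp_all add: eval_nat_numeral\<close>)
      qed
    qed simp
  qed simp_all
qed

lemma nonplanar_if_exponent_2_or_3:
  fixes n :: nat
  assumes n: "n = 2 \<or> n = 3" and exponent: "\<And>g. g \<in> carrier G \<Longrightarrow> g [^] n = \<one>"
    and W: "W \<subseteq> carrier G" "card W = 5"
  shows "\<not> planar (endomorphism_graph G)"
proof (rule nonplanar_if_max_order[OF _ exponent W])
  show "n > 0" using n by auto
  fix u and k :: int assume u: "u \<in> W" "u \<noteq> \<one>" "u [^] k = \<one>"
  have uc: "u \<in> carrier G" using u W by blast
  show "int n dvd k"
  proof (rule dvd_if_pow_eq_one[OF \<open>n > 0\<close> uc exponent[OF uc] _ u(3)])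
    fix r :: nat assume r: "0 < r" "r < n"
    show "u [^] r \<noteq> \<one>"
    proof
      assume eq: "u [^] r = \<one>"
      have "r = 1 \<or> r = 2 \<and> n = 3" using r n by auto
      then show False
      proof (elim disjE conjE)
        assume "r = 2" "n = 3"
        then have "u [^] (2::nat) \<otimes> u = u" "u [^] (2::nat) \<otimes> u = \<one>" 
          using eq uc exponent[OF uc] by (simp_all add: eval_nat_numeral)
        then show False using u by simp
      qed (use eq u uc in simp)
    qed
  qed
qed

text \<open>
  All elements have order at most \<open>4\<close>. Orders \<open>2\<close> or \<open>4\<close> and \<open>3\<close> do not occur together, as the product of two
  such elements would have order at least \<open>6\<close>. So the exponent divides \<open>3\<close> or \<open>4\<close>. In a group with five
  elements each of the possible exponents \<open>2\<close>, \<open>3\<close> and \<open>4\<close> leads to a clique.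
\<close>

lemma card_le_4_if_planar:
  assumes planar: "planar (endomorphism_graph G)"
  shows "finite (carrier G) \<and> card (carrier G) \<le> 4"
proof (rule ccontr)
  assume big: "\<not> (finite (carrier G) \<and> card (carrier G) \<le> 4)"
  have "\<exists>W \<subseteq> carrier G. card W = 5"
  proof (cases "finite (carrier G)")
    case True
    then have "5 \<le> card (carrier G)" using big by simp
    then obtain W where "W \<subseteq> carrier G" "card W = 5" by (rule obtain_subset_with_card_n)
    then show ?thesis by blast
  next
    case False
    then show ?thesis using infinite_arbitrarily_large by blast
  qed
  then obtain W where W: "W \<subseteq> carrier G" "card W = 5" by blast
  have order: "x [^] (1::nat) = \<one> \<or> x [^] (2::nat) = \<one> \<or> x [^] (3::nat) = \<one> \<or> x [^] (4::nat) = \<one>"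
    if x: "x \<in> carrier G" for x
  proof -
    obtain k :: int where k: "k \<in> {1..4}" "x [^] k = \<one>"
      using nonplanar_if_order_gt_4[OF x] planar by blast
    have "k = int 1 \<or> k = int 2 \<or> k = int 3 \<or> k = int 4" using k(1) by auto
    then show ?thesis using k(2) int_pow_int by metis
  qed
  obtain a where a: "a \<in> carrier G" "a [^] (2::nat) \<noteq> \<one>"
    using nonplanar_if_exponent_2_or_3[of 2, OF _ _ W] planar by blast
  obtain b where b: "b \<in> carrier G" "b [^] (3::nat) \<noteq> \<one>"
    using nonplanar_if_exponent_2_or_3[of 3, OF _ _ W] planar by blast
  have four: "x [^] (4::nat) = \<one> \<or> x [^] (3::nat) = \<one>" if x: "x \<in> carrier G" for x
  proof -
    have "x [^] (4::nat) = \<one>" if "x [^] (2::nat) = \<one>"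
      using nat_pow_pow[OF x, of 2 2] that by simp
    moreover have "x [^] (4::nat) = \<one>" if "x [^] (1::nat) = \<one>"
      using nat_pow_pow[OF x, of 1 4] that by simp
    ultimately show ?thesis using order[OF x] by blast
  qed
  \<comment> \<open>Otherwise \<open>g\<close> has order \<open>3\<close> and \<open>b\<close> has order \<open>2\<close> or \<open>4\<close>; then neither the third nor the fourth power
    of \<open>g \<otimes> b\<close> is trivial.\<close>
  have exponent: "g [^] (4::nat) = \<one>" if g: "g \<in> carrier G" for g
  proof (rule ccontr)
    assume g4: "g [^] (4::nat) \<noteq> \<one>"
    have "g [^] (3::nat) = \<one>" "b [^] (4::nat) = \<one>" using four g b g4 by blast+
    then have "(g \<otimes> b) [^] (4::nat) \<noteq> \<one>" "(g \<otimes> b) [^] (3::nat) \<noteq> \<one>"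
      using g4 g b by (simp_all add: nat_pow_distrib)
    then show False using four[of "g \<otimes> b"] g b by simp
  qed
  have a2: "a \<otimes> a \<noteq> \<one>" using a by (simp add: eval_nat_numeral)
  have "card {\<one>, a, inv a, inv (a \<otimes> a)} \<le> 4"
    by (simp add: card_insert_if)
  then have "\<not> W \<subseteq> {\<one>, a, inv a, inv (a \<otimes> a)}"
    using W(2) card_mono[of "{\<one>, a, inv a, inv (a \<otimes> a)}" W] by auto
  then obtain g where "g \<in> carrier G" "g \<notin> {\<one>, a, inv a, inv (a \<otimes> a)}" using W(1) by blast
  then show False using nonplanar_if_exponent_4[OF exponent a(1) a2] planar by blast
qed

end

theorem theorem6p6:
  fixes G :: "('a, 'b) monoid_scheme"
  assumes "comm_group G"
  shows "planar (endomorphism_graph G) \<longleftrightarrow> finite (carrier G) \<and> card (carrier G) \<le> 4"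
proof
  assume "planar (endomorphism_graph G)"
  then show "finite (carrier G) \<and> card (carrier G) \<le> 4"
    using comm_group.card_le_4_if_planar[OF assms] by blast
next
  assume "finite (carrier G) \<and> card (carrier G) \<le> 4"
  then show "planar (endomorphism_graph G)"
    by (intro planar_if_at_most_4_vertices) (auto simp: endomorphism_graph_def)
qed

end
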